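(* Consider the MQMS (multi-queue multi-server) system. If there exists a server allocation policy under which the system is (strongly) stable, then $$\alpha\,\overline{E[A(t)]^{\mathrm T}}\;\le\;\sum_{s\in\mathcal S}\pi_s\max_{I\in\mathcal I}\bigl(\alpha\,(C_s\circledast I)\,\underline 1_K^{\mathrm T}\bigr)\qquad\text{for all }\alpha\in\widehat V .$$
   Context: All vectors are row vectors; $\underline 1_K$ is the all-ones row vector of length $K$; $\circledast$ is the entrywise product of matrices; $(v)^+$ replaces negative entries of $v$ by $0$. For a function $f$ of time, $\overline{f(t)}=\lim_{t\to\infty}\frac1t\sum_{\tau=1}^t f(\tau)$ (this notation presupposes that the limit exists). MQMS system: time is slotted, $t=1,2,\dots$; $\mathcal N=\{1,\dots,N\}$ is the set of queues and $\mathcal K=\{1,\dots,K\}$ the set of servers. Let $M$ be a positive integer and $\mathcal M=\{0,1,\dots,M\}$. The channel state at slot $t$ is a random $N\times K$ matrix $C(t)=(C_{n,k}(t))$ with entries in $\mathcal M$; $\mathcal S$ is the (finite) index set of all such matrices, $C_s$ is the matrix with index $s$, and the channel process has stationary distribution $\pi_s=\Pr(C(t)=C_s)$ for all $t$. $A(t)=(A_1(t),\dots,A_N(t))$ is the vector of nonnegative numbers of packet arrivals in slot $t$, with $E[A_n^2(t)]\le A_{max}^2<\infty$ for all $n,t$. The set of allocation matrices is $\mathcal I=\{I\in\{0,1\}^{N\times K}:\sum_{n=1}^N I_{n,k}\le 1\ \forall k\in\mathcal K\}$. A server allocation policy selects, at the beginning of each slot $t$, a matrix $I(t)\in\mathcal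 I$ based on the available information on $C(t)$ and on the queue length vector $X(t-1)$. Queue lengths evolve by $$X^{\mathrm T}(t)=\bigl(X^{\mathrm T}(t-1)-(C(t)\circledast I(t))\underline 1_K^{\mathrm T}\bigr)^+ +A^{\mathrm T}(t),\qquad E[X_n(0)]<\infty .$$ The system is (strongly) stable if $\limsup_{t\to\infty}\frac1t\sum_{\tau=0}^{t-1}E[X_n(\tau)]<\infty$ for every $n$. The set $\widehat V$: for $\alpha\in\mathbb R^N$ and nonempty $\mathcal U\subseteq\mathcal N$, $\alpha_{\mathcal U}$ is the subvector of $\alpha$ with indices in $\mathcal U$. Let $V$ be the set of $\alpha\in\mathbb R_+^N$ (nonnegative entries) such that for every nonempty proper subset $\mathcal U\subset\mathcal N$ with $\alpha_{\mathcal U}\ne 0$ and $\alpha_{\mathcal U^c}\neq 0$ there exist $i\in\mathcal U$, $j\in\mathcal U^c$ with $\alpha_i,\alpha_j\ne0$ and nonzero $m,n\in\mathcal M$ with $\alpha_i m=\alpha_j n$. Let $\mathcal W=\{\prod_{j=1}^{N-1}m_j: m_j\in\mathcal M\}$. Then $\widehat V$ denotes a (finite) set of nonzero vectors in $V\cap\mathcal W^N$ such that every nonzero $\alpha\in V$ equals $q\beta$ for some $q>0$, $\beta\in\widehat V$. (Positively proportional vectors $\alpha$ give equivalent inequalities, so the choice of representatives is immaterial.) *)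

theory Defs
  imports "HOL-Probability.Probability"
begin

text \<open>
  Queues are indexed by a finite type \<open>'n\<close> and servers by a finite type \<open>'k\<close>, so
  \<open>N = CARD('n)\<close> and \<open>K = CARD('k)\<close>.  An \<open>N \<times> K\<close> matrix is an element of \<open>real^'k^'n\<close> with
  \<open>C $ n $ k\<close> the entry at queue \<open>n\<close> and server \<open>k\<close>; the all-ones vector of length \<open>K\<close> is
  \<open>1 :: real^'k\<close>, and row/column vectors are not distinguished.
\<close>

definition hadamard :: "real^'k^'n \<Rightarrow> real^'k^'n \<Rightarrow> real^'k^'n"  (infixl "\<circledast>" 70) where
  "C \<circledast> I = (\<chi> n k. C $ n $ k * I $ n $ k)"

definition pos_vec :: "real^'n \<Rightarrow> real^'n" where
  "pos_vec v = (\<chi> n. max 0 (v $ n))"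

text \<open>Channel matrices are not numbered: the state set plays the role of its own index set.\<close>

definition channel_states :: "nat \<Rightarrow> (real^'k^'n) set" where
  "channel_states M = {C. \<forall>n k. C $ n $ k \<in> real ` {0..M}}"

definition allocations :: "(real^'k^'n) set" where
  "allocations = {I. (\<forall>n k. I $ n $ k \<in> {0, 1}) \<and> (\<forall>k. (\<Sum>n\<in>UNIV. I $ n $ k) \<le> 1)}"

text \<open>Only the slots \<open>t \<ge> 1\<close> of \<open>C\<close> and \<open>A\<close> are meaningful.\<close>

locale mqms = prob_space P
  for P :: "'a measure" +
  fixes M :: nat
    and C :: "nat \<Rightarrow> 'a \<Rightarrow> real^'k^'n"
    and A :: "nat \<Rightarrow> 'a \<Rightarrow> real^'n"
    and A_max :: real
    and X0 :: "'a \<Rightarrow> real^'n"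
    and \<pi> :: "real^'k^'n \<Rightarrow> real"
  assumes M_pos: "M \<ge> 1"
    and C_random: "\<And>t. t \<ge> 1 \<Longrightarrow> random_variable borel (C t)"
    and C_range: "\<And>t \<omega>. t \<ge> 1 \<Longrightarrow> \<omega> \<in> space P \<Longrightarrow> C t \<omega> \<in> channel_states M"
    and C_distribution: "\<And>t c. t \<ge> 1 \<Longrightarrow> c \<in> channel_states M \<Longrightarrow>
          prob {\<omega> \<in> space P. C t \<omega> = c} = \<pi> c"
    and A_random: "\<And>t. t \<ge> 1 \<Longrightarrow> random_variable borel (A t)"
    and A_nonneg: "\<And>t \<omega> n. t \<ge> 1 \<Longrightarrow> \<omega> \<in> space P \<Longrightarrow> 0 \<le> A t \<omega> $ n"
    and A_square_integrable: "\<And>t n. t \<ge> 1 \<Longrightarrow> integrable P (\<lambda>\<omega>. (A t \<omega> $ n)\<^sup>2)"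
    and A_second_moment: "\<And>t n. t \<ge> 1 \<Longrightarrow> expectation (\<lambda>\<omega>. (A t \<omega> $ n)\<^sup>2) \<le> A_max\<^sup>2"
    and X0_random: "random_variable borel X0"
    and X0_nonneg: "\<And>\<omega> n. \<omega> \<in> space P \<Longrightarrow> 0 \<le> X0 \<omega> $ n"
    and X0_integrable: "\<And>n. integrable P (\<lambda>\<omega>. X0 \<omega> $ n)"

text \<open>
  A policy is a decision rule \<open>\<phi>\<close>, where \<open>\<phi> t c x u\<close> is the matrix chosen in slot \<open>t\<close> when
  \<open>C(t) = c\<close>, \<open>X(t-1) = x\<close> and the policy's own randomization (if any) takes the value \<open>u\<close>.
  The seeds \<open>U\<close> are independent of the initial queue lengths, arrivals and channel states, so
  that they carry no information about the system; deterministic policies simply ignore \<open>u\<close>.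
\<close>

definition allocation_policy ::
  "'a measure \<Rightarrow> (nat \<Rightarrow> 'a \<Rightarrow> real^'k^'n) \<Rightarrow> (nat \<Rightarrow> 'a \<Rightarrow> real^'n) \<Rightarrow> ('a \<Rightarrow> real^'n) \<Rightarrow>
   (nat \<Rightarrow> real^'k^'n \<Rightarrow> real^'n \<Rightarrow> real \<Rightarrow> real^'k^'n) \<Rightarrow> (nat \<Rightarrow> 'a \<Rightarrow> real) \<Rightarrow> bool" where
  "allocation_policy P C A X0 \<phi> U \<longleftrightarrow>
     (\<forall>t\<ge>1. \<forall>c x u. \<phi> t c x u \<in> allocations) \<and>
     (\<forall>t\<ge>1. (\<lambda>(c, x, u). \<phi> t c x u) \<in> borel \<Otimes>\<^sub>M borel \<Otimes>\<^sub>M borel \<rightarrow>\<^sub>M borel) \<and>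
     (\<forall>t\<ge>1. U t \<in> P \<rightarrow>\<^sub>M borel) \<and>
     prob_space.indep_set P
       (sets (vimage_algebra (space P) (\<lambda>\<omega>. \<lambda>t\<in>{1..}. U t \<omega>) (Pi\<^sub>M {1..} (\<lambda>_. borel))))
       (sets (vimage_algebra (space P)
          (\<lambda>\<omega>. (X0 \<omega>, (\<lambda>t\<in>{1..}. A t \<omega>), (\<lambda>t\<in>{1..}. C t \<omega>)))
          (borel \<Otimes>\<^sub>M Pi\<^sub>M {1..} (\<lambda>_. borel) \<Otimes>\<^sub>M Pi\<^sub>M {1..} (\<lambda>_. borel))))"

primrec queue_length ::
  "(nat \<Rightarrow> 'a \<Rightarrow> real^'k^'n) \<Rightarrow> (nat \<Rightarrow> 'a \<Rightarrow> real^'n) \<Rightarrow> ('a \<Rightarrow> real^'n) \<Rightarrow>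
   (nat \<Rightarrow> real^'k^'n \<Rightarrow> real^'n \<Rightarrow> real \<Rightarrow> real^'k^'n) \<Rightarrow> (nat \<Rightarrow> 'a \<Rightarrow> real) \<Rightarrow>
   nat \<Rightarrow> 'a \<Rightarrow> real^'n" where
  "queue_length C A X0 \<phi> U 0 \<omega> = X0 \<omega>"
| "queue_length C A X0 \<phi> U (Suc t) \<omega> =
     (let x = queue_length C A X0 \<phi> U t \<omega>;
          c = C (Suc t) \<omega>;
          I = \<phi> (Suc t) c x (U (Suc t) \<omega>)
      in pos_vec (x - (c \<circledast> I) *v 1) + A (Suc t) \<omega>)"

text \<open>
  Queue lengths are nonnegative, so their expectations are taken in \<open>[0, \<infinity>]\<close>; this avoids the
  convention that the Bochner integral of a non-integrable function is 0.
\<close>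

definition strongly_stable :: "'a measure \<Rightarrow> (nat \<Rightarrow> 'a \<Rightarrow> real^'n) \<Rightarrow> bool" where
  "strongly_stable P X \<longleftrightarrow>
     (\<forall>n. limsup (\<lambda>t. (\<Sum>\<tau><t. \<integral>\<^sup>+\<omega>. ennreal (X \<tau> \<omega> $ n) \<partial>P) / of_nat t) < \<infinity>)"

definition partial_average :: "(nat \<Rightarrow> real^'n) \<Rightarrow> nat \<Rightarrow> real^'n" where
  "partial_average f t = (1 / real t) *\<^sub>R (\<Sum>\<tau>=1..t. f \<tau>)"

definition time_average :: "(nat \<Rightarrow> real^'n) \<Rightarrow> real^'n" where
  "time_average f = lim (partial_average f)"

definition V_set :: "nat \<Rightarrow> (real^'n) set" where
  "V_set M = {\<alpha>. (\<forall>i. 0 \<le> \<alpha> $ i) \<and>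
     (\<forall>U. U \<noteq> {} \<and> U \<noteq> UNIV \<and> (\<exists>i\<in>U. \<alpha> $ i \<noteq> 0) \<and> (\<exists>j\<in>-U. \<alpha> $ j \<noteq> 0) \<longrightarrow>
        (\<exists>i\<in>U. \<exists>j\<in>-U. \<alpha> $ i \<noteq> 0 \<and> \<alpha> $ j \<noteq> 0 \<and>
           (\<exists>m\<in>{0..M}. \<exists>n\<in>{0..M}. m \<noteq> 0 \<and> n \<noteq> 0 \<and> \<alpha> $ i * real m = \<alpha> $ j * real n)))}"

definition W_vectors :: "nat \<Rightarrow> (real^'n) set" where
  "W_vectors M =
     {\<alpha>. \<forall>i. \<alpha> $ i \<in> {real (\<Prod>j=1..CARD('n) - 1. m j) | m :: nat \<Rightarrow> nat. \<forall>j. m j \<in> {0..M}}}"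

text \<open>The choice of representatives is left open: any admissible set is allowed.\<close>

definition is_V_hat :: "nat \<Rightarrow> (real^'n) set \<Rightarrow> bool" where
  "is_V_hat M Vh \<longleftrightarrow>
     finite Vh \<and> 0 \<notin> Vh \<and> Vh \<subseteq> V_set M \<inter> W_vectors M \<and>
     (\<forall>\<alpha>\<in>V_set M. \<alpha> \<noteq> 0 \<longrightarrow> (\<exists>q>0. \<exists>\<beta>\<in>Vh. \<alpha> = q *\<^sub>R \<beta>))"

text \<open>Sums over channel states and maxima over allocations range over finite (nonempty) sets.\<close>

lemma finite_vec_range:
  assumes "finite S"
  shows "finite {v :: 'b^'i. \<forall>i. v $ i \<in> S}"
proof (rule finite_subset)
  show "{v :: 'b^'i. \<forall>i. v $ i \<in> S} \<subseteq> vec_lambda ` PiE UNIV (\<lambda>_. S)"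
  proof
    fix v :: "'b^'i" assume "v \<in> {v. \<forall>i. v $ i \<in> S}"
    then have "vec_nth v \<in> PiE UNIV (\<lambda>_. S)" by (auto simp: PiE_def)
    then show "v \<in> vec_lambda ` PiE UNIV (\<lambda>_. S)"
      by (metis image_eqI vec_nth_inverse)
  qed
  show "finite (vec_lambda ` PiE UNIV (\<lambda>_ :: 'i. S))"
    using assms by (intro finite_imageI finite_PiE) auto
qed

lemma finite_channel_states: "finite (channel_states M :: (real^'k^'n) set)"
  using finite_vec_range[OF finite_vec_range[of "real ` {0..M}"]]
  by (simp add: channel_states_def)

lemma finite_allocations: "finite (allocations :: (real^'k^'n) set)"
  by (rule finite_subset[OF _ finite_vec_range[OF finite_vec_range[of "{0, 1}"]]])
    (auto simp: allocations_def)

lemma zero_in_allocations: "0 \<in> allocations"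
  by (simp add: allocations_def)

end

theory Submission
  imports Defs
begin

text \<open>
  Weighting the queues by \<open>\<alpha> \<ge> 0\<close>, one slot removes at most \<open>max\<^sub>I \<alpha> \<bullet> ((C(t) \<circledast> I) *v 1)\<close>
  whatever the policy does, so \<open>\<alpha> \<bullet> E[X(t)]\<close> is at least \<open>\<alpha> \<bullet> \<Sum> E[A(\<tau>)] - t G\<close> with \<open>G\<close> the
  right-hand side of the claim.  If the claim failed, \<open>\<alpha> \<bullet> E[X(t)]\<close> would grow linearly and its
  time averages could not stay bounded.
\<close>

section \<open>Linear growth against bounded time averages of a real sequence\<close>

text \<open>A positive limit would force \<open>x \<tau>\<close> above \<open>d * \<tau>\<close>
  from some slot on. The terms with index in \<open>{s..<2 * s}\<close> alone would then add up to
  at least \<open>d * s * s\<close>, quadratic in \<open>s\<close>, whereas the bound at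
  \<open>2 * s\<close> grows only linearly.\<close>

lemma linear_growth_limit_le_zero:
  fixes x u :: "nat \<Rightarrow> real"
  assumes nonneg: "\<And>t. 0 \<le> x t"
    and bound: "\<forall>\<^sub>F t in sequentially. (\<Sum>\<tau><t. x \<tau>) \<le> B * real t"
    and le: "\<And>t. t \<ge> 1 \<Longrightarrow> u t \<le> x t / real t"
    and lim: "u \<longlonglongrightarrow> L"
  shows "L \<le> 0"
proof (rule ccontr)
  assume "\<not> L \<le> 0"
  then obtain d where d: "0 < d" "d < L" using dense[of 0 L] by auto
  have "\<forall>\<^sub>F t in sequentially. d < u t"
    using lim d(2) by (rule order_tendstoD)
  then obtain S where S: "\<And>t. t \<ge> S \<Longrightarrow> d < u t"
    by (auto simp: eventually_sequentially)
  obtain T where T: "\<And>t. t \<ge> T \<Longrightarrow> (\<Sum>\<tau><t. x \<tau>) \<le> B * real t"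
    using bound by (auto simp: eventually_sequentially)
  obtain s0 :: nat where s0: "2 * B / d < real s0" using reals_Archimedean2 by blast
  \<comment> \<open>Large enough for both eventual statements and for \<open>2 * B < d * s\<close>;
    the extra 1 makes \<open>s\<close> positive, so that the division by \<open>\<tau>\<close> and
    the final cancellation of \<open>s\<close> are legitimate.\<close>
  define s where "s = S + T + s0 + 1"
  have growth: "d * real s \<le> x \<tau>" if "\<tau> \<in> {s..<2 * s}" for \<tau>
  proof -
    have "\<tau> \<ge> 1" "\<tau> \<ge> S" "s \<le> \<tau>" using that by (auto simp: s_def)
    have "d \<le> x \<tau> / real \<tau>"
      using S[OF \<open>\<tau> \<ge> S\<close>] le[OF \<open>\<tau> \<ge> 1\<close>] by simp
    then have "d * real \<tau> \<le> x \<tau>"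
      using \<open>\<tau> \<ge> 1\<close> by (simp add: field_simps)
    moreover have "d * real s \<le> d * real \<tau>" using d \<open>s \<le> \<tau>\<close> by simp
    ultimately show ?thesis by simp
  qed
  have "real s * (d * real s) = (\<Sum>\<tau>\<in>{s..<2 * s}. d * real s)" by simp
  also have "\<dots> \<le> (\<Sum>\<tau>\<in>{s..<2 * s}. x \<tau>)" using growth by (rule sum_mono)
  also have "\<dots> \<le> (\<Sum>\<tau><2 * s. x \<tau>)" using nonneg by (intro sum_mono2) auto
  also have "\<dots> \<le> B * real (2 * s)" by (rule T) (simp add: s_def)
  finally have "real s * (d * real s) \<le> real s * (2 * B)" by (simp add: mult_ac)
  moreover have "real s > 0" by (simp add: s_def)
  ultimately have "d * real s \<le> 2 * B" by simp
  moreover have "2 * B < d * real s0" using s0 d by (simp add: field_simps)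
  moreover have "d * real s0 \<le> d * real s" using d by (simp add: s_def)
  ultimately show False by simp
qed

text \<open>Converts stability, phrased in \<open>ennreal\<close>, into the real bound used above:
  any value strictly between the limsup and infinity is a finite real that eventually dominates the
  averages.\<close>

lemma limsup_average_finite_imp_linear_bound:
  fixes x :: "nat \<Rightarrow> real"
  assumes nonneg: "\<And>t. 0 \<le> x t"
    and fin: "limsup (\<lambda>t. (\<Sum>\<tau><t. ennreal (x \<tau>)) / of_nat t) < \<infinity>"
  shows "\<exists>B. \<forall>\<^sub>F t in sequentially. (\<Sum>\<tau><t. x \<tau>) \<le> B * real t"
proof -
  obtain b where b: "limsup (\<lambda>t. (\<Sum>\<tau><t. ennreal (x \<tau>)) / of_nat t) < b" "b < \<infinity>"
    using dense[OF fin] by blast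
  obtain B where B: "b = ennreal B" "0 \<le> B" using b(2) by (cases b) auto
  have "\<forall>\<^sub>F t in sequentially. (\<Sum>\<tau><t. ennreal (x \<tau>)) / of_nat t < b"
    using b(1) by (rule Limsup_lessD)
  then have "\<forall>\<^sub>F t in sequentially. (\<Sum>\<tau><t. x \<tau>) \<le> B * real t"
    \<comment> \<open>Positive \<open>t\<close> lets the \<open>ennreal\<close> quotient be read as
      a real one and multiplied out.\<close>
    using eventually_gt_at_top[of 0]
  proof eventually_elim
    case (elim t)
    have "(\<Sum>\<tau><t. ennreal (x \<tau>)) / of_nat t = ennreal ((\<Sum>\<tau><t. x \<tau>) / real t)"
      using elim(2) nonneg
      by (simp add: ennreal_of_nat_eq_real_of_nat divide_ennreal sum_nonneg)
    then have "(\<Sum>\<tau><t. x \<tau>) / real t < B"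
      using elim(1) B nonneg by (simp add: ennreal_less_iff sum_nonneg)
    then show ?case using elim(2) by (simp add: field_simps)
  qed
  then show ?thesis by blast
qed

section \<open>The one-slot update, service, and weighted vectors\<close>

text \<open>The update is a continuous function of the quadruple \<open>(c, I, x, a)\<close>, so it
  preserves measurability.\<close>

lemma borel_measurable_queue_step:
  fixes c I :: "'a \<Rightarrow> real^'k^'n" and x a :: "'a \<Rightarrow> real^'n"
  assumes [measurable]: "c \<in> borel_measurable P" "I \<in> borel_measurable P"
    "x \<in> borel_measurable P" "a \<in> borel_measurable P"
  shows "(\<lambda>\<omega>. pos_vec (x \<omega> - (c \<omega> \<circledast> I \<omega>) *v 1) + a \<omega>) \<in> borel_measurable P"
proof -
  let ?f = "\<lambda>(c :: real^'k^'n, I, x, a :: real^'n). pos_vec (x - (c \<circledast> I) *v 1) + a"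
  have "continuous_on UNIV ?f"
    unfolding pos_vec_def hadamard_def matrix_vector_mult_def case_prod_unfold
    by (intro continuous_intros)
  then have "?f \<in> borel_measurable borel" by (rule borel_measurable_continuous_onI)
  moreover have "(\<lambda>\<omega>. (c \<omega>, I \<omega>, x \<omega>, a \<omega>)) \<in> P \<rightarrow>\<^sub>M borel"
    by (intro borel_measurable_Pair assms)
  ultimately have "(\<lambda>\<omega>. ?f (c \<omega>, I \<omega>, x \<omega>, a \<omega>)) \<in> borel_measurable P"
    by (rule measurable_compose[rotated])
  then show ?thesis by simp
qed

lemma service_nonneg:
  assumes "c \<in> channel_states M" "I \<in> allocations"
  shows "0 \<le> ((c \<circledast> I) *v 1) $ n"
proof -
  have "0 \<le> c $ n $ k" "0 \<le> I $ n $ k" for k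
  proof -
    have "c $ n $ k \<in> real ` {0..M}" using assms(1) by (simp add: channel_states_def)
    then show "0 \<le> c $ n $ k" by auto
    have "I $ n $ k \<in> {0, 1}" using assms(2) by (simp add: allocations_def)
    then show "0 \<le> I $ n $ k" by auto
  qed
  then show ?thesis
    by (auto simp: hadamard_def matrix_vector_mult_def intro!: sum_nonneg)
qed

text \<open>A bound on weighted service that depends on the channel state alone, not on the policy
  or the queues; its expectation is therefore determined by \<open>\<pi>\<close>.\<close>

definition max_service :: "real^'n \<Rightarrow> real^'k^'n \<Rightarrow> real" where
  "max_service \<alpha> c = Max ((\<lambda>I. \<alpha> \<bullet> ((c \<circledast> I) *v 1)) ` allocations)"

lemma service_le_max_service:
  "I \<in> allocations \<Longrightarrow> \<alpha> \<bullet> ((c \<circledast> I) *v 1) \<le> max_service \<alpha> c"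
  unfolding max_service_def by (intro Max_ge finite_imageI finite_allocations imageI)

lemma inner_mono_cart:
  fixes \<alpha> v w :: "real^'n"
  assumes "\<And>i. 0 \<le> \<alpha> $ i" "\<And>i. v $ i \<le> w $ i"
  shows "\<alpha> \<bullet> v \<le> \<alpha> \<bullet> w"
  using assms by (auto simp: inner_vec_def intro!: sum_mono mult_left_mono)

lemma integrable_vec_cart:
  fixes f :: "'a \<Rightarrow> real^'n"
  assumes meas: "f \<in> borel_measurable M" and int: "\<And>n. integrable M (\<lambda>\<omega>. f \<omega> $ n)"
  shows "integrable M f"
proof (rule Bochner_Integration.integrable_bound[OF _ meas])
  show "integrable M (\<lambda>\<omega>. \<Sum>n\<in>UNIV. \<bar>f \<omega> $ n\<bar>)"
    by (intro Bochner_Integration.integrable_sum integrable_abs int)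
  show "AE \<omega> in M. norm (f \<omega>) \<le> norm (\<Sum>n\<in>UNIV. \<bar>f \<omega> $ n\<bar>)"
    using norm_le_l1_cart[of "f _"] by (auto intro!: AE_I2 order_trans[OF _ abs_ge_self])
qed

section \<open>Expectations of arrivals and of functions of the channel state\<close>

context mqms
begin

lemma integrable_arrivals:
  assumes "t \<ge> 1" shows "integrable P (A t)"
proof (rule integrable_vec_cart)
  show meas: "A t \<in> borel_measurable P" using A_random[OF assms] .
  fix n
  show "integrable P (\<lambda>\<omega>. A t \<omega> $ n)"
    by (rule square_integrable_imp_integrable[OF _ A_square_integrable[OF assms]])
      (rule measurable_compose[OF meas], intro borel_measurable_continuous_onI continuous_intros)
qed

text \<open>Only finitely many channel states occur, so \<open>g (C t)\<close> is a finite
  combination of indicators of the events \<open>C t = c\<close>, each of probability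
  \<open>\<pi> c\<close> in every slot.\<close>

lemma expectation_channel:
  assumes "t \<ge> 1"
  shows "integrable P (\<lambda>\<omega>. g (C t \<omega>))"
    and "expectation (\<lambda>\<omega>. g (C t \<omega>)) = (\<Sum>c\<in>channel_states M. \<pi> c * g c)"
proof -
  let ?E = "\<lambda>c. {\<omega> \<in> space P. C t \<omega> = c}"
  have [measurable]: "C t \<in> borel_measurable P" using C_random[OF assms] .
  have E: "?E c \<in> events" for c by measurable
  \<comment> \<open>Exactly one summand survives, the one with \<open>c = C t \<omega>\<close>,
    which \<open>C_range\<close> places in the index set.\<close>
  have eq: "g (C t \<omega>) = (\<Sum>c\<in>channel_states M. indicator (?E c) \<omega> * g c)"
    if "\<omega> \<in> space P" for \<omega>
  proof -
    have "(\<Sum>c\<in>channel_states M. indicator (?E c) \<omega> * g c)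
        = (\<Sum>c\<in>channel_states M. if c = C t \<omega> then g c else 0)"
      using that by (intro sum.cong) (auto simp: indicator_def)
    also have "\<dots> = g (C t \<omega>)"
      using C_range[OF assms that] by (simp add: finite_channel_states)
    finally show ?thesis by simp
  qed
  have int: "integrable P (\<lambda>\<omega>. indicator (?E c) \<omega> * g c)" for c
    using E by (intro integrable_mult_left integrable_real_indicator) (auto simp: emeasure_eq_measure)
  show "integrable P (\<lambda>\<omega>. g (C t \<omega>))"
    by (subst Bochner_Integration.integrable_cong[OF refl eq])
      (auto intro!: Bochner_Integration.integrable_sum int)
  have "expectation (\<lambda>\<omega>. g (C t \<omega>))
      = expectation (\<lambda>\<omega>. \<Sum>c\<in>channel_states M. indicator (?E c) \<omega> * g c)"
    by (rule Bochner_Integration.integral_cong[OF refl eq])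
  also have "\<dots> = (\<Sum>c\<in>channel_states M. expectation (\<lambda>\<omega>. indicator (?E c) \<omega> * g c))"
    by (rule Bochner_Integration.integral_sum[OF int])
  also have "\<dots> = (\<Sum>c\<in>channel_states M. \<pi> c * g c)"
  proof (rule sum.cong[OF refl])
    fix c :: "real^'k^'n" assume "c \<in> channel_states M"
    have "?E c \<inter> space P = ?E c" by auto
    then show "expectation (\<lambda>\<omega>. indicator (?E c) \<omega> * g c) = \<pi> c * g c"
      using C_distribution[OF assms \<open>c \<in> channel_states M\<close>] by simp
  qed
  finally show "expectation (\<lambda>\<omega>. g (C t \<omega>)) = (\<Sum>c\<in>channel_states M. \<pi> c * g c)" .
qed

section \<open>The queue process under a fixed, arbitrary policy\<close>

context
  fixes \<phi> U
  assumes policy: "allocation_policy P C A X0 \<phi> U"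
begin

abbreviation "X \<equiv> queue_length C A X0 \<phi> U"

abbreviation "alloc t \<omega> \<equiv> \<phi> (Suc t) (C (Suc t) \<omega>) (X t \<omega>) (U (Suc t) \<omega>)"

lemma queue_length_Suc:
  "X (Suc t) \<omega> = pos_vec (X t \<omega> - (C (Suc t) \<omega> \<circledast> alloc t \<omega>) *v 1) + A (Suc t) \<omega>"
  by (simp add: Let_def)

declare queue_length.simps(2) [simp del]

lemma alloc_in_allocations: "alloc t \<omega> \<in> allocations"
  using policy by (simp add: allocation_policy_def)

lemma borel_measurable_queue_length: "X t \<in> borel_measurable P"
proof (induction t)
  case 0
  then show ?case using X0_random by simp
next
  case (Suc t)
  have [measurable]: "C (Suc t) \<in> borel_measurable P" "A (Suc t) \<in> borel_measurable P"
    using C_random A_random by auto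
  have U: "U (Suc t) \<in> borel_measurable P"
    using policy by (simp add: allocation_policy_def)
  have \<phi>: "(\<lambda>(c, x, u). \<phi> (Suc t) c x u) \<in> borel \<Otimes>\<^sub>M borel \<Otimes>\<^sub>M borel \<rightarrow>\<^sub>M borel"
    using policy by (auto simp: allocation_policy_def)
  have "(\<lambda>\<omega>. (C (Suc t) \<omega>, X t \<omega>, U (Suc t) \<omega>)) \<in> P \<rightarrow>\<^sub>M borel \<Otimes>\<^sub>M borel \<Otimes>\<^sub>M borel"
    using Suc U by measurable
  from measurable_compose[OF this \<phi>] have "alloc t \<in> borel_measurable P" by simp
  then show ?case
    unfolding queue_length_Suc[abs_def] using Suc by (intro borel_measurable_queue_step) auto
qed

lemma queue_length_nonneg: "\<omega> \<in> space P \<Longrightarrow> 0 \<le> X t \<omega> $ n"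
  by (cases t) (auto simp: X0_nonneg A_nonneg queue_length_Suc pos_vec_def)

text \<open>Service is nonnegative, and the positive part cannot exceed the old length because that
  length is itself nonnegative. This supplies the domination for integrability.\<close>

lemma queue_length_Suc_le:
  assumes "\<omega> \<in> space P"
  shows "X (Suc t) \<omega> $ n \<le> X t \<omega> $ n + A (Suc t) \<omega> $ n"
  using service_nonneg[OF C_range[of "Suc t" \<omega>] alloc_in_allocations[of t \<omega>], of n]
    queue_length_nonneg[OF assms, of t n] assms
  by (simp add: queue_length_Suc pos_vec_def)

lemma integrable_queue_length: "integrable P (X t)"
proof (induction t)
  case 0
  have "X 0 = X0" by auto
  then show ?case by (simp add: integrable_vec_cart X0_random X0_integrable)
next
  case (Suc t)
  show ?case
  proof (rule Bochner_Integration.integrable_bound[OF _ borel_measurable_queue_length])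
    show "integrable P (\<lambda>\<omega>. X t \<omega> + A (Suc t) \<omega>)"
      using Suc integrable_arrivals by (intro Bochner_Integration.integrable_add) auto
    show "AE \<omega> in P. norm (X (Suc t) \<omega>) \<le> norm (X t \<omega> + A (Suc t) \<omega>)"
    proof (rule AE_I2, rule norm_le_componentwise_cart)
      fix \<omega> n assume "\<omega> \<in> space P"
      then show "norm (X (Suc t) \<omega> $ n) \<le> norm ((X t \<omega> + A (Suc t) \<omega>) $ n)"
        using queue_length_Suc_le[of \<omega> t n] queue_length_nonneg[of \<omega> "Suc t" n] by simp
    qed
  qed
qed

text \<open>Integrability makes the \<open>[0, \<infinity>]\<close>-valued expectation in the
  definition of stability a finite real one.\<close>

lemma nn_integral_queue_length:
  "(\<integral>\<^sup>+\<omega>. ennreal (X t \<omega> $ n) \<partial>P) = ennreal (expectation (X t) $ n)"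
proof -
  have "(\<integral>\<^sup>+\<omega>. ennreal (X t \<omega> $ n) \<partial>P) = ennreal (expectation (\<lambda>\<omega>. X t \<omega> $ n))"
    by (intro nn_integral_eq_integral integrable_bounded_linear[OF bounded_linear_vec_nth]
        integrable_queue_length AE_I2 queue_length_nonneg)
  also have "expectation (\<lambda>\<omega>. X t \<omega> $ n) = expectation (X t) $ n"
    by (rule integral_bounded_linear[OF bounded_linear_vec_nth integrable_queue_length])
  finally show ?thesis .
qed

lemma expectation_queue_length_nonneg: "0 \<le> expectation (X t) $ n"
proof -
  have "expectation (X t) $ n = expectation (\<lambda>\<omega>. X t \<omega> $ n)"
    by (rule integral_bounded_linear[OF bounded_linear_vec_nth integrable_queue_length, symmetric])
  also have "\<dots> \<ge> 0" by (intro Bochner_Integration.integral_nonneg queue_length_nonneg)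
  finally show ?thesis .
qed

section \<open>Lower bound on the weighted queue length\<close>

text \<open>Dropping the positive part only lowers each component, and nonnegative weights preserve
  this; the service removed by any allocation is at most \<open>max_service\<close>.\<close>

lemma weighted_queue_length_Suc_ge:
  assumes "\<And>i. 0 \<le> \<alpha> $ i"
  shows "\<alpha> \<bullet> X t \<omega> + \<alpha> \<bullet> A (Suc t) \<omega> - max_service \<alpha> (C (Suc t) \<omega>) \<le> \<alpha> \<bullet> X (Suc t) \<omega>"
proof -
  let ?s = "(C (Suc t) \<omega> \<circledast> alloc t \<omega>) *v 1"
  have "\<alpha> \<bullet> (X t \<omega> - ?s + A (Suc t) \<omega>) \<le> \<alpha> \<bullet> X (Suc t) \<omega>"
    by (rule inner_mono_cart[OF assms]) (simp add: queue_length_Suc pos_vec_def)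
  moreover have "\<alpha> \<bullet> ?s \<le> max_service \<alpha> (C (Suc t) \<omega>)"
    by (rule service_le_max_service[OF alloc_in_allocations])
  ultimately show ?thesis by (simp add: inner_add_right inner_diff_right)
qed

text \<open>The pathwise one-slot bound is integrated and accumulated by induction. Each slot costs
  the same constant \<open>G\<close>, since the channel distribution does not change with
  time.\<close>

lemma expectation_weighted_queue_length_ge:
  assumes \<alpha>: "\<And>i. 0 \<le> \<alpha> $ i"
  defines "G \<equiv> \<Sum>c\<in>channel_states M. \<pi> c * max_service \<alpha> c"
  shows "\<alpha> \<bullet> (\<Sum>\<tau>=1..t. expectation (A \<tau>)) - real t * G \<le> \<alpha> \<bullet> expectation (X t)"
proof (induction t)
  case 0
  \<comment> \<open>The initial content is bounded below by 0, so it does not appear in the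
    estimate.\<close>
  have "\<alpha> \<bullet> 0 \<le> \<alpha> \<bullet> expectation (X 0)"
    using \<alpha> by (rule inner_mono_cart) (simp add: expectation_queue_length_nonneg)
  then show ?case by (simp del: queue_length.simps)
next
  case (Suc t)
  have intX: "integrable P (\<lambda>\<omega>. \<alpha> \<bullet> X t \<omega>)" for t
    by (intro integrable_inner_right integrable_queue_length)
  have intA: "integrable P (\<lambda>\<omega>. \<alpha> \<bullet> A (Suc t) \<omega>)"
    by (intro integrable_inner_right integrable_arrivals) simp
  note ch = expectation_channel[of "Suc t" "max_service \<alpha>"]
  have "\<alpha> \<bullet> expectation (X t) + \<alpha> \<bullet> expectation (A (Suc t)) - G
      = expectation (\<lambda>\<omega>. \<alpha> \<bullet> X t \<omega> + \<alpha> \<bullet> A (Suc t) \<omega> - max_service \<alpha> (C (Suc t) \<omega>))"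
    using intX intA ch integrable_queue_length[of t] integrable_arrivals[of "Suc t"]
    by (simp add: G_def)
  also have "\<dots> \<le> expectation (\<lambda>\<omega>. \<alpha> \<bullet> X (Suc t) \<omega>)"
    using ch(1) \<alpha> by (intro integral_mono Bochner_Integration.integrable_diff
        Bochner_Integration.integrable_add intX intA weighted_queue_length_Suc_ge) auto
  also have "\<dots> = \<alpha> \<bullet> expectation (X (Suc t))"
    using integrable_queue_length[of "Suc t"] by simp
  finally show ?case using Suc by (simp add: inner_add_right algebra_simps)
qed

lemma strongly_stable_imp_arrival_rate_le:
  assumes stable: "strongly_stable P X"
    and conv: "partial_average (\<lambda>t. expectation (A t)) \<longlonglongrightarrow> a"
    and \<alpha>: "\<And>i. 0 \<le> \<alpha> $ i"
  shows "\<alpha> \<bullet> a \<le> (\<Sum>c\<in>channel_states M. \<pi> c * max_service \<alpha> c)" (is "_ \<le> ?G")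
proof -
  have "\<exists>B. \<forall>\<^sub>F t in sequentially. (\<Sum>\<tau><t. expectation (X \<tau>) $ n) \<le> B * real t" for n
    using stable expectation_queue_length_nonneg
    by (intro limsup_average_finite_imp_linear_bound)
      (auto simp: strongly_stable_def nn_integral_queue_length)
  then obtain B where B:
    "\<And>n. \<forall>\<^sub>F t in sequentially. (\<Sum>\<tau><t. expectation (X \<tau>) $ n) \<le> B n * real t"
    by metis
  \<comment> \<open>There are finitely many queues, so one threshold serves all of them, and the
    weighted sum inherits a linear bound.\<close>
  have "\<forall>\<^sub>F t in sequentially. \<forall>n. (\<Sum>\<tau><t. expectation (X \<tau>) $ n) \<le> B n * real t"
    using B by (rule eventually_all_finite)
  then have bound: "\<forall>\<^sub>F t in sequentially.
      (\<Sum>\<tau><t. \<alpha> \<bullet> expectation (X \<tau>)) \<le> (\<alpha> \<bullet> (\<chi> n. B n)) * real t"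
  proof eventually_elim
    case (elim t)
    have "\<alpha> \<bullet> (\<Sum>\<tau><t. expectation (X \<tau>)) \<le> \<alpha> \<bullet> (real t *\<^sub>R (\<chi> n. B n))"
      using \<alpha> by (rule inner_mono_cart) (use elim in \<open>simp add: mult.commute\<close>)
    then show ?case by (simp add: inner_sum_right mult.commute)
  qed
  \<comment> \<open>The growth lemma is applied to
    \<open>\<alpha> \<bullet> expectation (X t)\<close>; its comparison sequence is the accumulated
    lower bound divided by \<open>t\<close>, which tends to
    \<open>\<alpha> \<bullet> a - ?G\<close>.\<close>
  have "\<alpha> \<bullet> a - ?G \<le> 0"
  proof (rule linear_growth_limit_le_zero[OF _ bound])
    fix t
    have "\<alpha> \<bullet> 0 \<le> \<alpha> \<bullet> expectation (X t)"
      using \<alpha> by (rule inner_mono_cart) (simp add: expectation_queue_length_nonneg)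
    then show "0 \<le> \<alpha> \<bullet> expectation (X t)" by simp
  next
    fix t :: nat assume "t \<ge> 1"
    then show "\<alpha> \<bullet> partial_average (\<lambda>t. expectation (A t)) t - ?G \<le> \<alpha> \<bullet> expectation (X t) / real t"
      using divide_right_mono[OF expectation_weighted_queue_length_ge[OF \<alpha>, of t], of "real t"]
      by (simp add: partial_average_def diff_divide_distrib)
  next
    show "(\<lambda>t. \<alpha> \<bullet> partial_average (\<lambda>t. expectation (A t)) t - ?G) \<longlonglongrightarrow> \<alpha> \<bullet> a - ?G"
      by (intro tendsto_intros conv)
  qed
  then show ?thesis by simp
qed

end

end

theorem theorem1:
  fixes P :: "'a measure"
    and M :: nat
    and C :: "nat \<Rightarrow> 'a \<Rightarrow> real^'k^'n"
    and A :: "nat \<Rightarrow> 'a \<Rightarrow> real^'n"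
    and A_max :: real
    and X0 :: "'a \<Rightarrow> real^'n"
    and \<pi> :: "real^'k^'n \<Rightarrow> real"
    and Vh :: "(real^'n) set"
  assumes "mqms P M C A A_max X0 \<pi>"
    and "convergent (partial_average (\<lambda>t. \<integral>\<omega>. A t \<omega> \<partial>P))"
    and "is_V_hat M Vh"
    and "\<exists>\<phi> U. allocation_policy P C A X0 \<phi> U \<and> strongly_stable P (queue_length C A X0 \<phi> U)"
  shows "\<forall>\<alpha>\<in>Vh. \<alpha> \<bullet> time_average (\<lambda>t. \<integral>\<omega>. A t \<omega> \<partial>P)
      \<le> (\<Sum>c\<in>channel_states M. \<pi> c * Max ((\<lambda>I. \<alpha> \<bullet> ((c \<circledast> I) *v 1)) ` allocations))"
proof
  fix \<alpha> assume "\<alpha> \<in> Vh"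
  then have \<alpha>: "\<And>i. 0 \<le> \<alpha> $ i"
    using assms(3) by (auto simp: is_V_hat_def V_set_def)
  interpret mqms P M C A A_max X0 \<pi> by (rule assms(1))
  obtain \<phi> U where "allocation_policy P C A X0 \<phi> U"
    "strongly_stable P (queue_length C A X0 \<phi> U)"
    using assms(4) by blast
  \<comment> \<open>\<open>time_average\<close> is defined through \<open>lim\<close>; convergence
    of the averages makes it their actual limit.\<close>
  moreover have "partial_average (\<lambda>t. \<integral>\<omega>. A t \<omega> \<partial>P)
      \<longlonglongrightarrow> time_average (\<lambda>t. \<integral>\<omega>. A t \<omega> \<partial>P)"
    using assms(2) by (simp add: time_average_def convergent_LIMSEQ_iff)
  ultimately show "\<alpha> \<bullet> time_average (\<lambda>t. \<integral>\<omega>. A t \<omega> \<partial>P)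
      \<le> (\<Sum>c\<in>channel_states M. \<pi> c * Max ((\<lambda>I. \<alpha> \<bullet> ((c \<circledast> I) *v 1)) ` allocations))"
    using strongly_stable_imp_arrival_rate_le \<alpha> unfolding max_service_def by blast
qed

end
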